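(* Let $f$ be a 2-cell with four edges such that, expressed in polar coordinates $(r,\theta)$ on a chart of $f$, the edges are parametrised, for $t\in[0,1]$, by $$I_1(t)=(g_1(t),h(t)),\quad I_2(t)=(t+1,\theta_1),\quad I_3(t)=(g_3(t),h(t)),\quad I_4(t)=(t(a-1)+1,\theta_2),$$ where $h,g_1,g_3$ are $C^2$ and satisfy $h(0)=\theta_1$, $h(1)=\theta_2$, $g_1(0)=2$, $g_1(1)=a$, $g_3(0)=1$, $g_3(1)=1$. Assume that $h$ is strictly increasing with a derivative bounded from below by a positive constant, and that $g_1-g_3$ is strictly positive on $[0,1]$. Then the function $I_f:[0,1]^2\to\overline f$ given (in polar coordinates) by $$I_f(t,p):=\big(p\,g_1(t)+(1-p)\,g_3(t),\ h(t)\big)$$ provides affine compatible local coordinates on $f$: $I_f$ is a $C^2$-diffeomorphism onto $\overline f$ and, with $J_f:=I_f^{-1}$, for each $i\in\{1,2,3,4\}$ the map $J_f\circ I_i:[0,1]\to\mathbb R^2$ is affine.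
   Context: The cell is identified with its image in the polar coordinates $(r,\theta)$ of the chart; $\overline f$ is the closed region bounded by the four edges, i.e. the set of $(r,\theta)$ with $\theta=h(t)$ for some $t\in[0,1]$ and $g_3(t)\le r\le g_1(t)$. A $C^2$-diffeomorphism $I_f:U_f\subset\mathbb R^2\to\overline f$ is said to provide affine compatible local coordinates if, for every edge $E$ of $f$ with its chosen parametrisation $I_E:[0,1]\to\overline E$, the composition $I_f^{-1}\circ I_E$ is affine. *)

theory Defs
  imports "HOL-Analysis.Analysis"
begin

definition C2_open :: "'a::euclidean_space set \<Rightarrow> ('a \<Rightarrow> 'b::euclidean_space) \<Rightarrow> bool" where
  "C2_open U f \<longleftrightarrow>
     open U \<and>
     (\<exists>(f' :: 'a \<Rightarrow> 'a \<Rightarrow>\<^sub>L 'b) (f'' :: 'a \<Rightarrow> 'a \<Rightarrow>\<^sub>L ('a \<Rightarrow>\<^sub>L 'b)).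
        (\<forall>x\<in>U. (f has_derivative blinfun_apply (f' x)) (at x)) \<and>
        (\<forall>x\<in>U. (f' has_derivative blinfun_apply (f'' x)) (at x)) \<and>
        continuous_on U f'')"

text \<open>
  On an arbitrary set, in particular one with boundary, \<open>C\<^sup>2\<close> means having a \<open>C\<^sup>2\<close> extension
  to an open neighbourhood. On a compact interval this agrees with the definition by one-sided
  derivatives at the end points: extend by the second-order Taylor polynomials there.
\<close>

definition C2_on :: "'a::euclidean_space set \<Rightarrow> ('a \<Rightarrow> 'b::euclidean_space) \<Rightarrow> bool" where
  "C2_on S f \<longleftrightarrow> (\<exists>U F. S \<subseteq> U \<and> C2_open U F \<and> (\<forall>x\<in>S. F x = f x))"

definition C2_diffeo :: "'a::euclidean_space set \<Rightarrow> 'b::euclidean_space set \<Rightarrow> ('a \<Rightarrow> 'b) \<Rightarrow> bool" where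
  "C2_diffeo S T f \<longleftrightarrow> bij_betw f S T \<and> C2_on S f \<and> C2_on T (inv_into S f)"

definition affine_map_on :: "'a::real_vector set \<Rightarrow> ('a \<Rightarrow> 'b::real_vector) \<Rightarrow> bool" where
  "affine_map_on S f \<longleftrightarrow> (\<exists>L c. linear L \<and> (\<forall>x\<in>S. f x = L x + c))"

text \<open>
  \<open>F\<close> is the closed cell and \<open>Es\<close> the set of parametrisations, over \<open>[0,1]\<close>, of its edges. The
  inclusion \<open>E ` {0..1} \<subseteq> F\<close> makes \<open>inv_into U I \<circ> E\<close> meaningful, since \<open>inv_into U I\<close> is
  unspecified outside \<open>I ` U\<close>.
\<close>

definition affine_compatible_coords ::
  "(real \<times> real) set \<Rightarrow> (real \<times> real) set \<Rightarrow> (real \<Rightarrow> real \<times> real) set \<Rightarrow>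
     (real \<times> real \<Rightarrow> real \<times> real) \<Rightarrow> bool" where
  "affine_compatible_coords U F Es I \<longleftrightarrow>
     C2_diffeo U F I \<and>
     (\<forall>E\<in>Es. E ` {0..1} \<subseteq> F \<and> affine_map_on {0..1} (inv_into U I \<circ> E))"

text \<open>All points are pairs \<open>(r, \<theta>)\<close> of polar coordinates.\<close>

definition closed_cell :: "(real \<Rightarrow> real) \<Rightarrow> (real \<Rightarrow> real) \<Rightarrow> (real \<Rightarrow> real) \<Rightarrow> (real \<times> real) set" where
  "closed_cell h g1 g3 = {(r, \<theta>). \<exists>t\<in>{0..1}. \<theta> = h t \<and> g3 t \<le> r \<and> r \<le> g1 t}"

end

theory Submission
  imports Defs
begin

text \<open>
  Extend \<open>h\<close>, \<open>g1\<close>, \<open>g3\<close> to \<open>C\<^sup>2\<close> functions \<open>H\<close>, \<open>G1\<close>, \<open>G3\<close> on one open interval around \<open>[0,1]\<close>,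
  so small that \<open>H' > 0\<close> and \<open>G1 > G3\<close> on it. By the one-dimensional inverse function theorem
  \<open>H\<close> has a \<open>C\<^sup>2\<close> inverse \<open>K\<close> on an open set, and
  \<open>(r, \<theta>) \<mapsto> (K \<theta>, (r - G3 (K \<theta>)) / (G1 (K \<theta>) - G3 (K \<theta>)))\<close>
  is a \<open>C\<^sup>2\<close> extension of the inverse of \<open>I\<close>. The edges pull back to the sides of the
  unit square.
\<close>

section \<open>Rules for building \<open>C2_open\<close> maps on Euclidean spaces\<close>

lemma C2_openI:
  fixes f :: "'a::euclidean_space \<Rightarrow> 'b::euclidean_space"
  assumes "open U"
    and "\<And>x. x \<in> U \<Longrightarrow> (f has_derivative blinfun_apply (f' x)) (at x)"
    and "\<And>x. x \<in> U \<Longrightarrow> (f' has_derivative blinfun_apply (f'' x)) (at x)"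
    and "continuous_on U f''"
  shows "C2_open U f"
  unfolding C2_open_def
proof (intro conjI exI)
  show "\<forall>x\<in>U. (f has_derivative blinfun_apply (f' x)) (at x)"
    by (rule ballI) (rule assms(2))
  show "\<forall>x\<in>U. (f' has_derivative blinfun_apply (f'' x)) (at x)"
    by (rule ballI) (rule assms(3))
qed (fact assms)+

lemma C2_openE:
  fixes f :: "'a::euclidean_space \<Rightarrow> 'b::euclidean_space"
  assumes "C2_open U f"
  obtains f' :: "'a \<Rightarrow> 'a \<Rightarrow>\<^sub>L 'b" and f'' :: "'a \<Rightarrow> 'a \<Rightarrow>\<^sub>L ('a \<Rightarrow>\<^sub>L 'b)"
  where "open U"
    and "\<And>x. x \<in> U \<Longrightarrow> (f has_derivative blinfun_apply (f' x)) (at x)"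
    and "\<And>x. x \<in> U \<Longrightarrow> (f' has_derivative blinfun_apply (f'' x)) (at x)"
    and "continuous_on U f''"
  using assms unfolding C2_open_def
proof (elim conjE exE)
  fix f' f''
  assume "open U" "\<forall>x\<in>U. (f has_derivative blinfun_apply (f' x)) (at x)"
    "\<forall>x\<in>U. (f' has_derivative blinfun_apply (f'' x)) (at x)" "continuous_on U f''"
  then show thesis by (intro that[of f' f'']) simp_all
qed

lemma C2_open_imp_continuous_on:
  assumes "C2_open U f"
  shows "continuous_on U f"
proof -
  obtain f' where f': "\<And>x. x \<in> U \<Longrightarrow> (f has_derivative blinfun_apply (f' x)) (at x)"
    using assms by (rule C2_openE) blast
  show ?thesis
    by (intro continuous_at_imp_continuous_on ballI has_derivative_continuous[OF f'])
qed

lemma C2_open_subset: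
  assumes "C2_open U f" "open V" "V \<subseteq> U"
  shows "C2_open V f"
proof -
  obtain f' f'' where f: "\<And>x. x \<in> U \<Longrightarrow> (f has_derivative blinfun_apply (f' x)) (at x)"
    "\<And>x. x \<in> U \<Longrightarrow> (f' has_derivative blinfun_apply (f'' x)) (at x)" "continuous_on U f''"
    using assms(1) by (rule C2_openE) blast
  show ?thesis
    using \<open>open V\<close> f(1,2)[OF subsetD[OF \<open>V \<subseteq> U\<close>]] continuous_on_subset[OF f(3) \<open>V \<subseteq> U\<close>]
    by (rule C2_openI)
qed

lemma C2_open_bounded_linear:
  assumes "bounded_linear f" "open U"
  shows "C2_open U f"
proof (rule C2_openI)
  show "(f has_derivative blinfun_apply (Blinfun f)) (at x)" for x
    using assms by (simp add: bounded_linear_Blinfun_apply bounded_linear_imp_has_derivative)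
  show "((\<lambda>x. Blinfun f) has_derivative blinfun_apply 0) (at x)" for x
    by (simp add: zero_blinfun.rep_eq)
qed (use assms in auto)

text \<open>The derivative \<open>D z\<close> sends \<open>v\<close> to
  \<open>B (fst z) (snd v) + B (fst v) (snd z)\<close>. It depends linearly on \<open>z\<close>, so
  the second derivative is the constant \<open>Blinfun D\<close>. Multiplication of reals is the
  instance behind the product rule below.\<close>

lemma C2_open_bounded_bilinear:
  fixes B :: "'a::euclidean_space \<Rightarrow> 'b::euclidean_space \<Rightarrow> 'c::euclidean_space"
  assumes "bounded_bilinear B" "open U"
  shows "C2_open U (\<lambda>z. B (fst z) (snd z))"
proof -
  interpret bounded_bilinear B by fact
  define D where "D z = Blinfun (\<lambda>v. B (fst z) (snd v) + B (fst v) (snd z))" for z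
  have D: "blinfun_apply (D z) = (\<lambda>v. B (fst z) (snd v) + B (fst v) (snd z))" for z
    unfolding D_def
    by (intro bounded_linear_Blinfun_apply bounded_linear_add
        bounded_linear_compose[OF bounded_linear_right] bounded_linear_compose[OF bounded_linear_left]
        bounded_linear_fst bounded_linear_snd)
  have "linear D"
    by (intro linearI blinfun_eqI) (simp_all add: D blinfun.bilinear_simps add_left add_right scaleR_left scaleR_right
        algebra_simps)
  then have "bounded_linear D"
    by (simp add: linear_conv_bounded_linear)
  show ?thesis
  proof (rule C2_openI)
    show "((\<lambda>z. B (fst z) (snd z)) has_derivative blinfun_apply (D z)) (at z)" for z
      unfolding D by (auto intro!: derivative_eq_intros FDERIV)
    show "(D has_derivative blinfun_apply (Blinfun D)) (at z)" for z
      using \<open>bounded_linear D\<close>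
      by (simp add: bounded_linear_Blinfun_apply bounded_linear_imp_has_derivative)
  qed (use assms in auto)
qed

text \<open>The first derivative is the composition of \<open>g' (f x)\<close> and
  \<open>f' x\<close>. Composition of bounded linear maps is itself bounded bilinear, so the product
  rule differentiates this expression once more, and the result is continuous because each
  ingredient is.\<close>

lemma C2_open_compose:
  fixes f :: "'a::euclidean_space \<Rightarrow> 'b::euclidean_space" and g :: "'b \<Rightarrow> 'c::euclidean_space"
  assumes f: "C2_open U f" and g: "C2_open V g" and sub: "f ` U \<subseteq> V"
  shows "C2_open U (\<lambda>x. g (f x))"
proof -
  obtain f' f'' where "open U"
    and f1: "\<And>x. x \<in> U \<Longrightarrow> (f has_derivative blinfun_apply (f' x)) (at x)"
    and f2: "\<And>x. x \<in> U \<Longrightarrow> (f' has_derivative blinfun_apply (f'' x)) (at x)"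
    and f3: "continuous_on U f''"
    using f by (rule C2_openE) blast
  obtain g' g'' where "open V"
    and g1: "\<And>y. y \<in> V \<Longrightarrow> (g has_derivative blinfun_apply (g' y)) (at y)"
    and g2: "\<And>y. y \<in> V \<Longrightarrow> (g' has_derivative blinfun_apply (g'' y)) (at y)"
    and g3: "continuous_on V g''"
    using g by (rule C2_openE) blast
  interpret C: bounded_bilinear "(o\<^sub>L) :: 'b \<Rightarrow>\<^sub>L 'c \<Rightarrow> 'a \<Rightarrow>\<^sub>L 'b \<Rightarrow> 'a \<Rightarrow>\<^sub>L 'c"
    by (rule bounded_bilinear_blinfun_compose)
  \<comment> \<open>The first summand differentiates the outer factor \<open>g' (f x)\<close> by the
    chain rule and keeps \<open>f' x\<close>; the second keeps \<open>g' (f x)\<close> and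
    differentiates \<open>f' x\<close>.\<close>
  define D2 where "D2 x = (C.prod_left (f' x) o\<^sub>L (g'' (f x) o\<^sub>L f' x)) + (C.prod_right (g' (f x)) o\<^sub>L f'' x)"
    for x
  have contf: "continuous_on U f" "continuous_on U f'"
    using has_derivative_continuous[OF f1] has_derivative_continuous[OF f2]
    by (blast intro: continuous_at_imp_continuous_on)+
  have contg: "continuous_on V g'"
    by (intro continuous_at_imp_continuous_on ballI has_derivative_continuous[OF g2])
  show ?thesis
  proof (rule C2_openI)
    fix x assume x: "x \<in> U"
    then have fx: "f x \<in> V" using sub by blast
    show "((\<lambda>x. g (f x)) has_derivative blinfun_apply (g' (f x) o\<^sub>L f' x)) (at x)"
      using has_derivative_compose[OF f1[OF x] g1[OF fx]] by (simp add: blinfun_compose.rep_eq o_def)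
    show "((\<lambda>x. g' (f x) o\<^sub>L f' x) has_derivative blinfun_apply (D2 x)) (at x)"
      using C.FDERIV[OF has_derivative_compose[OF f1[OF x] g2[OF fx]] f2[OF x]]
      by (rule has_derivative_eq_rhs) (simp add: D2_def plus_blinfun.rep_eq fun_eq_iff add.commute)
  next
    show "continuous_on U D2"
      unfolding D2_def
      by (intro continuous_on_add bounded_bilinear.continuous_on[OF bounded_bilinear_blinfun_compose]
          bounded_linear.continuous_on[OF C.bounded_linear_prod_left]
          bounded_linear.continuous_on[OF C.bounded_linear_prod_right]
          contf f3 continuous_on_compose2[OF g3 contf(1) sub] continuous_on_compose2[OF contg contf(1) sub])
  qed (fact \<open>open U\<close>)
qed

lemma C2_open_linear_compose:
  fixes f :: "'a::euclidean_space \<Rightarrow> 'b::euclidean_space" and L :: "'b \<Rightarrow> 'c::euclidean_space"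
  assumes "bounded_linear L" "C2_open U f"
  shows "C2_open U (\<lambda>x. L (f x))"
  using assms(2) C2_open_bounded_linear[OF assms(1) open_UNIV] subset_UNIV by (rule C2_open_compose)

lemma C2_open_add:
  assumes "C2_open U f" "C2_open U g"
  shows "C2_open U (\<lambda>x. f x + g x)"
proof -
  obtain f' f'' where f: "open U" "\<And>x. x \<in> U \<Longrightarrow> (f has_derivative blinfun_apply (f' x)) (at x)"
    "\<And>x. x \<in> U \<Longrightarrow> (f' has_derivative blinfun_apply (f'' x)) (at x)" "continuous_on U f''"
    using assms(1) by (rule C2_openE) blast
  obtain g' g'' where g: "\<And>x. x \<in> U \<Longrightarrow> (g has_derivative blinfun_apply (g' x)) (at x)"
    "\<And>x. x \<in> U \<Longrightarrow> (g' has_derivative blinfun_apply (g'' x)) (at x)" "continuous_on U g''"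
    using assms(2) by (rule C2_openE) blast
  show ?thesis
  proof (rule C2_openI)
    show "((\<lambda>x. f x + g x) has_derivative blinfun_apply (f' x + g' x)) (at x)" if "x \<in> U" for x
      using has_derivative_add[OF f(2) g(1), OF that that] by (simp add: plus_blinfun.rep_eq)
    show "((\<lambda>x. f' x + g' x) has_derivative blinfun_apply (f'' x + g'' x)) (at x)" if "x \<in> U" for x
      using has_derivative_add[OF f(3) g(2), OF that that] by (simp add: plus_blinfun.rep_eq)
  qed (use f(1,4) g(3) in \<open>auto intro: continuous_on_add\<close>)
qed

text \<open>The pair is the sum of \<open>(f x, 0)\<close> and \<open>(0, g x)\<close>, each a
  linear embedding applied to a \<open>C2_open\<close> map.\<close>

lemma C2_open_Pair:
  fixes f :: "'a::euclidean_space \<Rightarrow> 'b::euclidean_space" and g :: "'a \<Rightarrow> 'c::euclidean_space"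
  assumes "C2_open U f" "C2_open U g"
  shows "C2_open U (\<lambda>x. (f x, g x))"
proof -
  have "bounded_linear (\<lambda>y. (y, 0 :: 'c))" "bounded_linear (\<lambda>y. (0 :: 'b, y))"
    by (intro bounded_linear_Pair bounded_linear_ident bounded_linear_zero)+
  from C2_open_add[OF this(1)[THEN C2_open_linear_compose, OF assms(1)]
      this(2)[THEN C2_open_linear_compose, OF assms(2)]]
  show ?thesis by simp
qed

lemma C2_open_diff:
  assumes "C2_open U f" "C2_open U g"
  shows "C2_open U (\<lambda>x. f x - g x)"
  using C2_open_add[OF assms(1) C2_open_linear_compose[OF bounded_linear_minus[OF bounded_linear_ident] assms(2)]]
  by simp

lemma C2_open_mult:
  fixes f g :: "'a::euclidean_space \<Rightarrow> real"
  assumes "C2_open U f" "C2_open U g"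
  shows "C2_open U (\<lambda>x. f x * g x)"
  using C2_open_compose[OF C2_open_Pair[OF assms] C2_open_bounded_bilinear[OF bounded_bilinear_mult open_UNIV]]
  by simp

section \<open>Real functions: scalar derivatives, reciprocals and inverses\<close>

lemma C2_open_realI:
  fixes f :: "real \<Rightarrow> real"
  assumes "open U"
    and f': "\<And>x. x \<in> U \<Longrightarrow> (f has_real_derivative f' x) (at x)"
    and f'': "\<And>x. x \<in> U \<Longrightarrow> (f' has_real_derivative f'' x) (at x)"
    and cont: "continuous_on U f''"
  shows "C2_open U f"
proof -
  \<comment> \<open>\<open>L\<close> turns a scalar derivative \<open>c\<close> into the linear map
    that multiplies by \<open>c\<close>, and \<open>M\<close> does the same for derivatives with
    values in the space of such maps. Both are bounded linear, so differentiability and continuity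
    carry over.\<close>
  define L :: "real \<Rightarrow> real \<Rightarrow>\<^sub>L real" where "L = blinfun_scaleR_left"
  have L: "bounded_linear L" "\<And>c. blinfun_apply (L c) = (\<lambda>v. v * c)"
    unfolding L_def by (simp_all add: bounded_linear_blinfun_scaleR_left fun_eq_iff)
  define M :: "(real \<Rightarrow>\<^sub>L real) \<Rightarrow> real \<Rightarrow>\<^sub>L (real \<Rightarrow>\<^sub>L real)" where "M = blinfun_scaleR_left"
  have M: "bounded_linear M" "\<And>c. blinfun_apply (M c) = (\<lambda>v. v *\<^sub>R c)"
    unfolding M_def by (simp_all add: bounded_linear_blinfun_scaleR_left fun_eq_iff)
  show ?thesis
  proof (rule C2_openI)
    fix x assume x: "x \<in> U"
    show "(f has_derivative blinfun_apply (L (f' x))) (at x)"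
      using f'[OF x] unfolding L has_field_derivative_def by (simp add: mult.commute[of _ "f' x"])
    have "((\<lambda>x. L (f' x)) has_derivative (\<lambda>v. L (f'' x * v))) (at x)"
      using bounded_linear.has_derivative[OF L(1)] f''[OF x] by (simp add: has_field_derivative_def)
    moreover have "L (f'' x * v) = v *\<^sub>R L (f'' x)" for v
      using linear_cmul[OF bounded_linear.linear[OF L(1)], of v "f'' x"] by (simp add: mult.commute)
    ultimately show "((\<lambda>x. L (f' x)) has_derivative blinfun_apply (M (L (f'' x)))) (at x)"
      by (simp add: M)
  next
    show "continuous_on U (\<lambda>x. M (L (f'' x)))"
      by (intro bounded_linear.continuous_on[OF M(1)] bounded_linear.continuous_on[OF L(1)] cont)
  qed (fact \<open>open U\<close>)
qed

lemma C2_open_realE: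
  fixes f :: "real \<Rightarrow> real"
  assumes "C2_open U f"
  obtains f' f'' where "open U"
    and "\<And>x. x \<in> U \<Longrightarrow> (f has_real_derivative f' x) (at x)"
    and "\<And>x. x \<in> U \<Longrightarrow> (f' has_real_derivative f'' x) (at x)"
    and "continuous_on U f''"
proof -
  obtain f' f'' where *: "open U"
    "\<And>x. x \<in> U \<Longrightarrow> (f has_derivative blinfun_apply (f' x)) (at x)"
    "\<And>x. x \<in> U \<Longrightarrow> (f' has_derivative blinfun_apply (f'' x)) (at x)"
    "continuous_on U f''"
    using assms by (rule C2_openE) blast
  show thesis
  \<comment> \<open>A linear map on the reals is determined by its value at 1, so evaluating there
    recovers the scalar derivatives.\<close>
  proof (rule that[of "\<lambda>x. f' x 1" "\<lambda>x. f'' x 1 1"])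
    fix x assume x: "x \<in> U"
    have "blinfun_apply (f' x) v = f' x 1 * v" for v
      using blinfun.scaleR_right[of "f' x" v 1] by (simp only: real_scaleR_def mult_1_left mult_1_right mult.commute)
    then have "blinfun_apply (f' x) = (*) (f' x 1)"
      by (rule ext)
    then show "(f has_real_derivative f' x 1) (at x)"
      using *(2)[OF x] by (simp only: has_field_derivative_def)
    have "blinfun_apply (blinfun_apply (f'' x) v) 1 = f'' x 1 1 * v" for v
      using blinfun.scaleR_right[of "f'' x" v 1]
      by (simp only: real_scaleR_def mult_1_left mult_1_right mult.commute scaleR_blinfun.rep_eq)
    then have "(\<lambda>v. f'' x v 1) = (*) (f'' x 1 1)"
      by (rule ext)
    moreover have "((\<lambda>x. f' x 1) has_derivative (\<lambda>v. f'' x v 1)) (at x)"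
      using bounded_linear.has_derivative[OF blinfun.bounded_linear_left *(3)[OF x]] .
    ultimately show "((\<lambda>x. f' x 1) has_real_derivative f'' x 1 1) (at x)"
      by (simp only: has_field_derivative_def)
  qed (use * in \<open>auto intro!: continuous_intros\<close>)
qed

lemma C2_open_inverse:
  fixes f :: "'a::euclidean_space \<Rightarrow> real"
  assumes "C2_open U f" "\<And>x. x \<in> U \<Longrightarrow> f x \<noteq> 0"
  shows "C2_open U (\<lambda>x. inverse (f x))"
proof (rule C2_open_compose[OF assms(1)])
  show "C2_open (- {0}) (inverse :: real \<Rightarrow> real)"
    by (rule C2_open_realI[of _ _ "\<lambda>x. - (inverse x ^ 2)" "\<lambda>x. 2 * inverse x ^ 3"])
      (auto intro!: derivative_eq_intros continuous_intros
        simp: power2_eq_square power3_eq_cube field_simps)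
qed (use assms in auto)

lemma C2_open_inv_into:
  fixes f :: "real \<Rightarrow> real"
  assumes f: "C2_open U f" and inj: "inj_on f U"
    and nz: "\<And>x. x \<in> U \<Longrightarrow> \<not> (f has_real_derivative 0) (at x)"
  shows "C2_open (f ` U) (inv_into U f)"
proof -
  obtain f' f'' where "open U"
    and f1: "\<And>x. x \<in> U \<Longrightarrow> (f has_real_derivative f' x) (at x)"
    and f2: "\<And>x. x \<in> U \<Longrightarrow> (f' has_real_derivative f'' x) (at x)"
    and f3: "continuous_on U f''"
    using f by (rule C2_open_realE) blast
  define k where "k = inv_into U f"
  have k: "k y \<in> U" "f (k y) = y" if "y \<in> f ` U" for y
    using that by (simp_all add: k_def inv_into_into f_inv_into_f)
  have contf: "continuous_on U f"
    by (rule C2_open_imp_continuous_on[OF f])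
  have op: "open (f ` U)"
    using contf \<open>open U\<close> inj by (rule invariance_of_domain)
  have contk: "continuous_on (f ` U) k"
    unfolding k_def using contf \<open>open U\<close> inj by (intro continuous_on_inverse_open) auto
  have nz': "f' x \<noteq> 0" if "x \<in> U" for x
    using f1[OF that] nz[OF that] by auto
  have k1: "(k has_real_derivative inverse (f' (k y))) (at y)" if y: "y \<in> f ` U" for y
    by (rule has_field_derivative_inverse_basic[OF f1 _ _ op y])
      (use k y nz' contk op in \<open>auto simp: continuous_on_eq_continuous_at\<close>)
  have "C2_open (f ` U) k"
  proof (rule C2_open_realI[OF op k1])
    fix y assume y: "y \<in> f ` U"
    show "((\<lambda>y. inverse (f' (k y))) has_real_derivative
        - (f'' (k y) * inverse (f' (k y)) * inverse (f' (k y) ^ Suc (Suc 0)))) (at y)"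
      by (intro DERIV_inverse_fun DERIV_chain2[of f', OF f2 k1] nz' k y)
  next
    have "continuous_on U f'"
      using f2 by (meson DERIV_isCont continuous_at_imp_continuous_on)
    moreover have "k ` f ` U \<subseteq> U" using k by blast
    ultimately show "continuous_on (f ` U)
       (\<lambda>y. - (f'' (k y) * inverse (f' (k y)) * inverse (f' (k y) ^ Suc (Suc 0))))"
      using nz' k(1)
      by (intro continuous_intros continuous_on_compose2[OF f3 contk]
          continuous_on_compose2[OF _ contk, of U f']) auto
  qed
  then show ?thesis by (simp add: k_def)
qed

text \<open>Small intervals around the two end points, together with \<open>{a..b}\<close>, cover an
  open interval. An interval is wanted, and not just an open set, because a positive derivative
  forces strict monotonicity only on a connected domain.\<close>

lemma open_superset_Icc_Ioo:
  fixes a b :: real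
  assumes "open V" "{a..b} \<subseteq> V" "a \<le> b"
  obtains l u where "l < a" "b < u" "{l<..<u} \<subseteq> V"
proof -
  obtain d where d: "d > 0" "{a - d<..<a + d} \<subseteq> V"
    using assms openE[of V a] by (force simp: ball_eq_greaterThanLessThan)
  obtain e where e: "e > 0" "{b - e<..<b + e} \<subseteq> V"
    using assms openE[of V b] by (force simp: ball_eq_greaterThanLessThan)
  have "{a - d<..<b + e} \<subseteq> {a - d<..<a + d} \<union> {a..b} \<union> {b - e<..<b + e}"
    using d e by auto
  then have "{a - d<..<b + e} \<subseteq> V"
    using d e assms by blast
  with d e show thesis by (intro that[of "a - d" "b + e"]) auto
qed

lemma C2_onE:
  assumes "C2_on S f"
  obtains U F where "S \<subseteq> U" "C2_open U F" "open U" "\<And>x. x \<in> S \<Longrightarrow> F x = f x"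
  using assms unfolding C2_on_def C2_open_def by metis

section \<open>The cell, its coordinate map and its edges\<close>

theorem lemma34:
  fixes h g1 g3 h' :: "real \<Rightarrow> real"
    and \<theta>1 \<theta>2 a c :: real
    and I1 I2 I3 I4 :: "real \<Rightarrow> real \<times> real"
    and I :: "real \<times> real \<Rightarrow> real \<times> real"
  assumes I1: "\<And>t. t \<in> {0..1} \<Longrightarrow> I1 t = (g1 t, h t)"
    and I2: "\<And>t. t \<in> {0..1} \<Longrightarrow> I2 t = (t + 1, \<theta>1)"
    and I3: "\<And>t. t \<in> {0..1} \<Longrightarrow> I3 t = (g3 t, h t)"
    and I4: "\<And>t. t \<in> {0..1} \<Longrightarrow> I4 t = (t * (a - 1) + 1, \<theta>2)"
    and C2: "C2_on {0..1} h" "C2_on {0..1} g1" "C2_on {0..1} g3"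
    and h_ends: "h 0 = \<theta>1" "h 1 = \<theta>2"
    and g1_ends: "g1 0 = 2" "g1 1 = a"
    and g3_ends: "g3 0 = 1" "g3 1 = 1"
    and h_mono: "strict_mono_on {0..1} h"
    and h_deriv: "\<And>t. t \<in> {0..1} \<Longrightarrow> (h has_real_derivative h' t) (at t within {0..1})"
    and c_pos: "0 < c"
    and h_deriv_bound: "\<And>t. t \<in> {0..1} \<Longrightarrow> c \<le> h' t"
    and gap: "\<And>t. t \<in> {0..1} \<Longrightarrow> 0 < g1 t - g3 t"
    and I: "\<And>t p. t \<in> {0..1} \<Longrightarrow> p \<in> {0..1} \<Longrightarrow>
              I (t, p) = (p * g1 t + (1 - p) * g3 t, h t)"
  shows "affine_compatible_coords ({0..1} \<times> {0..1}) (closed_cell h g1 g3) {I1, I2, I3, I4} I"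
proof -
  let ?S = "{0..1} \<times> {0..1} :: (real \<times> real) set"
  let ?F = "closed_cell h g1 g3"
  obtain U0 H where H: "{0..1} \<subseteq> U0" "C2_open U0 H" "open U0" "\<And>t. t \<in> {0..1} \<Longrightarrow> H t = h t"
    using C2(1) by (rule C2_onE) blast
  obtain U1 G1 where G1: "{0..1} \<subseteq> U1" "C2_open U1 G1" "open U1" "\<And>t. t \<in> {0..1} \<Longrightarrow> G1 t = g1 t"
    using C2(2) by (rule C2_onE) blast
  obtain U3 G3 where G3: "{0..1} \<subseteq> U3" "C2_open U3 G3" "open U3" "\<And>t. t \<in> {0..1} \<Longrightarrow> G3 t = g3 t"
    using C2(3) by (rule C2_onE) blast
  obtain H' H'' where H': "\<And>t. t \<in> U0 \<Longrightarrow> (H has_real_derivative H' t) (at t)"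
    and H'': "\<And>t. t \<in> U0 \<Longrightarrow> (H' has_real_derivative H'' t) (at t)"
    using H(2) by (rule C2_open_realE) blast
  \<comment> \<open>\<open>H'\<close> is the derivative of the extension and \<open>h'\<close> that
    of \<open>h\<close> relative to \<open>[0,1]\<close>. They agree, also at the end points,
    because derivatives within a nondegenerate interval are unique. Hence the bound \<open>c\<close>
    applies to \<open>H'\<close>.\<close>
  have H'_eq: "H' t = h' t" if t: "t \<in> {0..1}" for t
  proof -
    have "(H has_real_derivative H' t) (at t within {0..1})"
      using H' H(1) t by (blast intro: has_field_derivative_at_within)
    then have "(h has_real_derivative H' t) (at t within {0..1})"
      by (rule has_field_derivative_transform_within[OF _ zero_less_one t]) (rule H(4))
    then show ?thesis
      using h_deriv[OF t] t
      by (intro vector_derivative_unique_within_closed_interval[of 0 1 t h])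
        (auto simp: has_real_derivative_iff_has_vector_derivative)
  qed
  define W where "W = U0 \<inter> U1 \<inter> U3"
  have W: "open W" "{0..1} \<subseteq> W"
    using H G1 G3 by (auto simp: W_def)
  \<comment> \<open>The minimum packs both positivity conditions into one continuous function, so
    that \<open>V\<close> is an open preimage.\<close>
  define V where "V = {t \<in> W. 0 < min (H' t) (G1 t - G3 t)}"
  have "continuous_on W H'"
    using H'' by (intro continuous_at_imp_continuous_on ballI DERIV_isCont[of _ "H'' _"]) (auto simp: W_def)
  moreover have "continuous_on W G1" "continuous_on W G3"
    using C2_open_imp_continuous_on[OF G1(2)] C2_open_imp_continuous_on[OF G3(2)]
    by (auto simp: W_def intro: continuous_on_subset)
  ultimately have "continuous_on W (\<lambda>t. min (H' t) (G1 t - G3 t))"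
    by (intro continuous_intros)
  then have "open (W \<inter> (\<lambda>t. min (H' t) (G1 t - G3 t)) -` {0<..})"
    using W(1) open_greaterThan by (rule continuous_open_preimage)
  moreover have "W \<inter> (\<lambda>t. min (H' t) (G1 t - G3 t)) -` {0<..} = V"
    by (auto simp: V_def)
  ultimately have "open V" by simp
  have "{0..1} \<subseteq> V"
    using W(2) H'_eq G1(4) G3(4) h_deriv_bound c_pos gap by (fastforce simp: V_def)
  then obtain l u where lu: "l < 0" "1 < u" "{l<..<u} \<subseteq> V"
    by (rule open_superset_Icc_Ioo[OF \<open>open V\<close> _ zero_le_one])
  define T where "T = {l<..<u}"
  have T: "open T" "{0..1} \<subseteq> T" "T \<subseteq> U0" "T \<subseteq> U1" "T \<subseteq> U3"
    and pos: "\<And>t. t \<in> T \<Longrightarrow> 0 < H' t" "\<And>t. t \<in> T \<Longrightarrow> G3 t < G1 t"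
    using lu by (auto simp: T_def V_def W_def)
  have C2T: "C2_open T H" "C2_open T G1" "C2_open T G3"
    using C2_open_subset[OF H(2)] C2_open_subset[OF G1(2)] C2_open_subset[OF G3(2)] T by blast+
  \<comment> \<open>Since \<open>T\<close> is an interval, it contains everything between
    \<open>x\<close> and \<open>y\<close>, and \<open>H' > 0\<close> holds on that whole
    segment.\<close>
  have "H x < H y" if "x \<in> T" "y \<in> T" "x < y" for x y
  proof (rule DERIV_pos_imp_increasing[OF \<open>x < y\<close>])
    fix t assume "x \<le> t" "t \<le> y"
    with that have "t \<in> T" by (auto simp: T_def)
    with H' pos(1) T(3) show "\<exists>d. (H has_real_derivative d) (at t) \<and> 0 < d" by blast
  qed
  then have inj: "inj_on H T"
    by (intro linorder_inj_onI') (metis less_irrefl)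
  define K where "K = inv_into T H"
  have C2K: "C2_open (H ` T) K"
    unfolding K_def using C2T(1) inj
  proof (rule C2_open_inv_into)
    show "\<not> (H has_real_derivative 0) (at t)" if "t \<in> T" for t
      using DERIV_unique[OF H'[of t], of 0] pos(1)[OF that] T(3) that by auto
  qed
  have KH: "K (H t) = t" if "t \<in> T" for t
    using inj that by (simp add: K_def)

  \<comment> \<open>The second component is the solution \<open>p\<close> of
    \<open>r = p * G1 t + (1 - p) * G3 t\<close> at \<open>t = K \<theta>\<close>.\<close>
  define J where "J z = (K (snd z), (fst z - G3 (K (snd z))) * inverse (G1 (K (snd z)) - G3 (K (snd z))))"
    for z :: "real \<times> real"
  have JI: "J (I z) = z" if "z \<in> ?S" for z
  proof -
    obtain t p where z: "z = (t, p)" "t \<in> {0..1}" "p \<in> {0..1}" using \<open>z \<in> ?S\<close> by blast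
    have "K (h t) = t" using KH H(4) T(2) z by (metis subsetD)
    then show ?thesis
      using z gap[of t] by (simp add: J_def I G1 G3 field_simps)
  qed
  have injI: "inj_on I ?S"
    using JI by (rule inj_on_inverseI)
  have img: "I ` ?S = ?F"
  proof
    show "I ` ?S \<subseteq> ?F"
    proof (rule image_subsetI)
      fix z assume "z \<in> ?S"
      then obtain t p where z: "z = (t, p)" and tp: "t \<in> {0..1}" "p \<in> {0..1}" by blast
      \<comment> \<open>With \<open>r\<close> the first component of \<open>I z\<close>, these two
        products are \<open>r - g3 t\<close> and \<open>g1 t - r\<close>.\<close>
      have "0 \<le> p * (g1 t - g3 t)" "0 \<le> (1 - p) * (g1 t - g3 t)"
        using tp gap[of t] by auto
      then show "I z \<in> ?F"
        using tp by (auto simp: z I closed_cell_def algebra_simps intro!: bexI[of _ t])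
    qed
    show "?F \<subseteq> I ` ?S"
    proof
      fix z assume "z \<in> ?F"
      then obtain r t where z: "z = (r, h t)" "t \<in> {0..1}" "g3 t \<le> r" "r \<le> g1 t"
        by (auto simp: closed_cell_def)
      define p where "p = (r - g3 t) / (g1 t - g3 t)"
      have "p \<in> {0..1}" using z gap[of t] by (simp add: p_def)
      moreover have "p * (g1 t - g3 t) = r - g3 t" using z gap[of t] by (simp add: p_def)
      then have "z = I (t, p)" using z \<open>p \<in> {0..1}\<close> by (simp add: I algebra_simps)
      ultimately show "z \<in> I ` ?S" using z by blast
    qed
  qed
  have inv: "inv_into ?S I z = J z" if "z \<in> ?F" for z
    using that JI inv_into_f_f[OF injI] unfolding img[symmetric] by force
  \<comment> \<open>The formula for \<open>I\<close>, with the extended functions put in, makes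
    sense on \<open>T \<times> UNIV\<close>: it is linear in \<open>p\<close> up to a constant, so
    \<open>p\<close> needs no restriction.\<close>
  have C2I: "C2_on ?S I"
    unfolding C2_on_def
  proof (intro exI conjI ballI)
    have f: "C2_open (T \<times> UNIV) (\<lambda>z :: real \<times> real. fst z)"
      and s: "C2_open (T \<times> UNIV) (\<lambda>z :: real \<times> real. snd z)"
      using T(1) by (intro C2_open_bounded_linear bounded_linear_fst bounded_linear_snd open_Times open_UNIV; simp)+
    have comp: "C2_open (T \<times> UNIV) (\<lambda>z :: real \<times> real. g (fst z))" if "C2_open T g" for g :: "real \<Rightarrow> real"
      by (rule C2_open_compose[OF f that]) auto
    show "C2_open (T \<times> UNIV)
        (\<lambda>z :: real \<times> real. (snd z * (G1 (fst z) - G3 (fst z)) + G3 (fst z), H (fst z)))"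
      by (intro C2_open_Pair C2_open_add C2_open_mult C2_open_diff comp s C2T)
    show "?S \<subseteq> T \<times> UNIV" using T(2) by auto
    show "(snd z * (G1 (fst z) - G3 (fst z)) + G3 (fst z), H (fst z)) = I z" if "z \<in> ?S" for z
      using that by (auto simp: I H G1 G3 algebra_simps)
  qed
  have C2J: "C2_on ?F (inv_into ?S I)"
    unfolding C2_on_def
  proof (intro exI conjI ballI)
    have "open (H ` T)" using C2K by (simp add: C2_open_def)
    then have f: "C2_open (UNIV \<times> H ` T) (\<lambda>z :: real \<times> real. fst z)"
      and s: "C2_open (UNIV \<times> H ` T) (\<lambda>z :: real \<times> real. snd z)"
      by (intro C2_open_bounded_linear bounded_linear_fst bounded_linear_snd open_Times open_UNIV; simp)+
    have K: "C2_open (UNIV \<times> H ` T) (\<lambda>z :: real \<times> real. K (snd z))"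
      by (rule C2_open_compose[OF s C2K]) auto
    have comp: "C2_open (UNIV \<times> H ` T) (\<lambda>z :: real \<times> real. g (K (snd z)))" if "C2_open T g" for g :: "real \<Rightarrow> real"
      by (rule C2_open_compose[OF K that]) (auto simp: KH)
    have "G1 (K (snd z)) - G3 (K (snd z)) \<noteq> 0" if "z \<in> (UNIV :: real set) \<times> H ` T" for z
      using that pos(2) by (force simp: KH)
    then show "C2_open (UNIV \<times> H ` T) J"
      unfolding J_def
      by (intro C2_open_Pair C2_open_mult C2_open_inverse C2_open_diff comp f K C2T)
    show "?F \<subseteq> UNIV \<times> H ` T"
      using T(2) H(4) by (force simp: closed_cell_def)
    show "J z = inv_into ?S I z" if "z \<in> ?F" for z
      by (simp only: inv[OF that])
  qed
  \<comment> \<open>If an edge is \<open>I\<close> after an affine map into the square, injectivity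
    of \<open>I\<close> makes that affine map its pullback.\<close>
  have side: "E ` {0..1} \<subseteq> ?F \<and> affine_map_on {0..1} (inv_into ?S I \<circ> E)"
    if L: "linear L" and E: "\<And>t. t \<in> {0..1} \<Longrightarrow> L t + b \<in> ?S \<and> E t = I (L t + b)" for E L b
  proof
    show "E ` {0..1} \<subseteq> ?F" using E img by blast
    show "affine_map_on {0..1} (inv_into ?S I \<circ> E)"
      unfolding affine_map_on_def using L E inv_into_f_f[OF injI] by (intro exI[of _ L] exI[of _ b]) auto
  qed
  have lin: "linear (\<lambda>t :: real. (t, 0 :: real))" "linear (\<lambda>t :: real. (0 :: real, t))"
    by (auto intro!: linearI)
  \<comment> \<open>With coordinates \<open>(t, p)\<close> on the square, the edges are, in order,
    the sides \<open>p = 1\<close>, \<open>t = 0\<close>, \<open>p = 0\<close> and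
    \<open>t = 1\<close>. The end values of \<open>g1\<close> and \<open>g3\<close> give the second
    and fourth: \<open>I (0, s) = (s + 1, \<theta>1)\<close> and
    \<open>I (1, s) = (s * (a - 1) + 1, \<theta>2)\<close>.\<close>
  have "\<forall>E \<in> {I1, I2, I3, I4}. E ` {0..1} \<subseteq> ?F \<and> affine_map_on {0..1} (inv_into ?S I \<circ> E)"
    using side[OF lin(1), of "(0, 1)" I1] side[OF lin(2), of "(0, 0)" I2]
      side[OF lin(1), of "(0, 0)" I3] side[OF lin(2), of "(1, 0)" I4]
    by (simp add: I I1 I2 I3 I4 h_ends g1_ends g3_ends algebra_simps)
  then show ?thesis
    unfolding affine_compatible_coords_def C2_diffeo_def bij_betw_def
    using injI img C2I C2J by blast
qed

end
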